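(* Let $X$ be a complex Banach space with Schauder basis $\{e_n\}_{n\in\mathbb{N}}$. Then the mapping $\Phi:\mathcal{H}L_0(B_X)\to \mathcal{H}^\infty_s(B_X,X^* )$ given by $\Phi(f)=df$ is an isometric isomorphism, where $$\mathcal{H}^\infty_s(B_X,X^* )=\{g\in \mathcal{H}^\infty(B_X,X^* ) : e_k\circ d(e_n\circ g)=e_n\circ d(e_k\circ g)\ \text{ for all } n,k\in\mathbb{N}\},$$ endowed with the norm inherited from $\mathcal{H}^\infty(B_X,X^* )$.
   Context: $B_X$ is the open unit ball of $X$ and $X^*$ is the topological dual of $X$. For a complex Banach space $Y$, a map $f:B_X\to Y$ is holomorphic if it is (complex) Fréchet differentiable at every point of $B_X$; its differential at $x$ is the continuous complex-linear map $df(x):X\to Y$. $\mathcal{H}^\infty(B_X,Y)$ is the Banach space of bounded holomorphic maps $f:B_X\to Y$ with norm $\|f\|=\sup_{x\in B_X}\|f(x)\|$. $\mathcal{H}L_0(B_X)$ is the Banach space of all bounded holomorphic functions $f:B_X\to\mathbb{C}$ which are Lipschitz and satisfy $f(0)=0$, with norm $L(f)=\sup\{|f(x)-f(y)|/\|x-y\| : x\ne y\in B_X\}$. For a map $g:B_X\to X^*$ and $x\in X$, $x\circ g:B_X\to\mathbb{C}$ denotes the function $u\mapsto g(u)(x)$. In particular, for holomorphic $g$ and $x,y\in X$, $y\circ d(x\circ g)$ is the function $u\mapsto d(x\circ g)(u)(y)$. An isometric isomorphism is a surjective linear isometry. *)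

theory Defs
  imports "HOL-Analysis.Analysis"
begin

section \<open>Complex normed spaces\<close>

class complex_normed_vector = real_normed_vector +
  fixes scaleC :: "complex \<Rightarrow> 'a \<Rightarrow> 'a" (infixr "*\<^sub>C" 75)
  assumes scaleC_add_right: "c *\<^sub>C (x + y) = c *\<^sub>C x + c *\<^sub>C y"
    and scaleC_add_left: "(c + d) *\<^sub>C x = c *\<^sub>C x + d *\<^sub>C x"
    and scaleC_scaleC: "c *\<^sub>C d *\<^sub>C x = (c * d) *\<^sub>C x"
    and scaleR_scaleC: "r *\<^sub>R x = complex_of_real r *\<^sub>C x"
    and norm_scaleC: "norm (c *\<^sub>C x) = cmod c * norm x"

class complex_banach = complex_normed_vector + banach

instantiation complex :: complex_banach
begin

definition scaleC_complex :: "complex \<Rightarrow> complex \<Rightarrow> complex"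
  where "scaleC_complex c z = c * z"

instance
  by standard (auto simp: scaleC_complex_def algebra_simps norm_mult scaleR_conv_of_real)

end

lemma bounded_linear_scaleC_right: "bounded_linear ((*\<^sub>C) (c :: complex))"
proof (rule bounded_linear_intro[where K = "cmod c"])
  fix r :: real and x :: 'a
  show "c *\<^sub>C r *\<^sub>R x = r *\<^sub>R c *\<^sub>C x"
    by (simp add: scaleR_scaleC scaleC_scaleC mult.commute)
qed (auto simp: scaleC_add_right norm_scaleC mult.commute)

section \<open>Bounded complex-linear maps\<close>

typedef (overloaded) ('a, 'b) clinfun =
  "{f :: 'a::complex_normed_vector \<Rightarrow> 'b::complex_normed_vector.
      bounded_linear f \<and> (\<forall>c x. f (c *\<^sub>C x) = c *\<^sub>C f x)}"
  morphisms clinfun_apply CLinfun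
proof -
  have "0 = c *\<^sub>C (0 :: 'b)" for c
    using linear_0[OF bounded_linear.linear[OF bounded_linear_scaleC_right[of c, where 'a='b]]] by simp
  then show ?thesis by (intro exI[of _ "\<lambda>_. 0"]) auto
qed

setup_lifting type_definition_clinfun

lemma scaleC_zero_right [simp]: "c *\<^sub>C (0 :: 'a::complex_normed_vector) = 0"
  using linear_0[OF bounded_linear.linear[OF bounded_linear_scaleC_right[of c, where 'a='a]]] by simp

lemma scaleC_minus_right: "c *\<^sub>C (- x) = - (c *\<^sub>C (x :: 'a::complex_normed_vector))"
  using linear_neg[OF bounded_linear.linear[OF bounded_linear_scaleC_right[of c, where 'a='a]]] by simp

lemma scaleC_diff_right: "c *\<^sub>C (x - y) = c *\<^sub>C x - c *\<^sub>C (y :: 'a::complex_normed_vector)"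
  using linear_diff[OF bounded_linear.linear[OF bounded_linear_scaleC_right[of c, where 'a='a]]] by simp

lemma onorm_scaleC:
  fixes f :: "'a::real_normed_vector \<Rightarrow> 'b::complex_normed_vector"
  assumes "bounded_linear f"
  shows "onorm (\<lambda>x. c *\<^sub>C f x) = cmod c * onorm f"
proof (cases "c = 0")
  case True
  then have "(\<lambda>x. c *\<^sub>C f x) = (\<lambda>x. 0)"
    by (metis mult_zero_left norm_eq_zero norm_scaleC norm_zero)
  then show ?thesis using True by (simp add: onorm_zero)
next
  case False
  have lin: "bounded_linear (\<lambda>x. c *\<^sub>C f x)"
    by (rule bounded_linear_compose[OF bounded_linear_scaleC_right assms])
  have "onorm (\<lambda>x. c *\<^sub>C f x) \<le> cmod c * onorm f"
    by (rule onorm_bound)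
      (auto simp: norm_scaleC mult.assoc onorm_pos_le[OF assms] intro!: mult_left_mono onorm[OF assms])
  moreover have "onorm f \<le> onorm (\<lambda>x. c *\<^sub>C f x) / cmod c"
  proof (rule onorm_bound)
    fix x
    show "norm (f x) \<le> onorm (\<lambda>x. c *\<^sub>C f x) / cmod c * norm x"
      using onorm[OF lin, of x] False by (simp add: norm_scaleC field_simps)
  qed (simp add: onorm_pos_le[OF lin])
  ultimately show ?thesis using False by (simp add: field_simps)
qed

instantiation clinfun :: (complex_normed_vector, complex_normed_vector) complex_normed_vector
begin

lift_definition norm_clinfun :: "('a, 'b) clinfun \<Rightarrow> real" is onorm .

lift_definition zero_clinfun :: "('a, 'b) clinfun" is "\<lambda>x. 0"
  by auto

lift_definition plus_clinfun :: "('a, 'b) clinfun \<Rightarrow> ('a, 'b) clinfun \<Rightarrow> ('a, 'b) clinfun"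
  is "\<lambda>f g x. f x + g x"
  by (auto simp: scaleC_add_right intro: bounded_linear_add)

lift_definition uminus_clinfun :: "('a, 'b) clinfun \<Rightarrow> ('a, 'b) clinfun" is "\<lambda>f x. - f x"
  by (auto simp: scaleC_minus_right intro: bounded_linear_minus)

lift_definition minus_clinfun :: "('a, 'b) clinfun \<Rightarrow> ('a, 'b) clinfun \<Rightarrow> ('a, 'b) clinfun"
  is "\<lambda>f g x. f x - g x"
  by (auto simp: scaleC_diff_right intro: bounded_linear_sub)

lift_definition scaleC_clinfun :: "complex \<Rightarrow> ('a, 'b) clinfun \<Rightarrow> ('a, 'b) clinfun"
  is "\<lambda>c f x. c *\<^sub>C f x"
  by (auto simp: scaleC_scaleC mult.commute
      intro: bounded_linear_compose[OF bounded_linear_scaleC_right])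

definition scaleR_clinfun :: "real \<Rightarrow> ('a, 'b) clinfun \<Rightarrow> ('a, 'b) clinfun"
  where "scaleR_clinfun r f = complex_of_real r *\<^sub>C f"

definition sgn_clinfun :: "('a, 'b) clinfun \<Rightarrow> ('a, 'b) clinfun"
  where "sgn_clinfun f = inverse (norm f) *\<^sub>R f"

definition dist_clinfun :: "('a, 'b) clinfun \<Rightarrow> ('a, 'b) clinfun \<Rightarrow> real"
  where "dist_clinfun f g = norm (f - g)"

definition uniformity_clinfun :: "(('a, 'b) clinfun \<times> ('a, 'b) clinfun) filter"
  where "uniformity_clinfun = (INF e\<in>{0 <..}. principal {(x, y). dist x y < e})"

definition open_clinfun :: "('a, 'b) clinfun set \<Rightarrow> bool"
  where "open_clinfun S = (\<forall>x\<in>S. \<forall>\<^sub>F (x', y) in uniformity. x' = x \<longrightarrow> y \<in> S)"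

instance
proof
  fix x y z :: "('a, 'b) clinfun" and r s :: real and c d :: complex
  show "dist x y = norm (x - y)" by (rule dist_clinfun_def)
  show "sgn x = inverse (norm x) *\<^sub>R x" by (rule sgn_clinfun_def)
  show "(uniformity :: (('a, 'b) clinfun \<times> ('a, 'b) clinfun) filter)
      = (INF e\<in>{0 <..}. principal {(x, y). dist x y < e})"
    by (rule uniformity_clinfun_def)
  show "open S = (\<forall>x\<in>S. \<forall>\<^sub>F (x', y) in uniformity. x' = x \<longrightarrow> y \<in> S)"
    for S :: "('a, 'b) clinfun set" by (rule open_clinfun_def)
  show "(x + y) + z = x + (y + z)" by transfer (simp add: add.assoc)
  show "x + y = y + x" by transfer (simp add: add.commute)
  show "0 + x = x" by transfer simp
  show "- x + x = 0" by transfer simp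
  show "x - y = x + - y" by transfer simp
  show "r *\<^sub>R (x + y) = r *\<^sub>R x + r *\<^sub>R y"
    unfolding scaleR_clinfun_def by transfer (simp add: scaleC_add_right)
  show "(r + s) *\<^sub>R x = r *\<^sub>R x + s *\<^sub>R x"
    unfolding scaleR_clinfun_def by transfer (simp add: scaleC_add_left)
  show "r *\<^sub>R s *\<^sub>R x = (r * s) *\<^sub>R x"
    unfolding scaleR_clinfun_def by transfer (simp add: scaleC_scaleC)
  show "1 *\<^sub>R x = x"
    unfolding scaleR_clinfun_def by transfer (simp add: scaleR_scaleC[of 1, simplified, symmetric])
  show "norm x = 0 \<longleftrightarrow> x = 0" by transfer (auto simp: onorm_eq_0)
  show "norm (x + y) \<le> norm x + norm y" by transfer (auto simp: onorm_triangle)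
  show "norm (r *\<^sub>R x) = \<bar>r\<bar> * norm x"
    unfolding scaleR_clinfun_def by transfer (auto simp: onorm_scaleC)
  show "c *\<^sub>C (x + y) = c *\<^sub>C x + c *\<^sub>C y" by transfer (simp add: scaleC_add_right)
  show "(c + d) *\<^sub>C x = c *\<^sub>C x + d *\<^sub>C x" by transfer (simp add: scaleC_add_left)
  show "c *\<^sub>C d *\<^sub>C x = (c * d) *\<^sub>C x" by transfer (simp add: scaleC_scaleC)
  show "r *\<^sub>R x = complex_of_real r *\<^sub>C x" by (rule scaleR_clinfun_def)
  show "norm (c *\<^sub>C x) = cmod c * norm x" by transfer (auto simp: onorm_scaleC)
qed

end

lift_definition blinfun_of_clinfun ::
  "('a::complex_normed_vector, 'b::complex_normed_vector) clinfun \<Rightarrow> 'a \<Rightarrow>\<^sub>L 'b"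
  is "\<lambda>f. f" by simp

lemma dist_blinfun_of_clinfun: "dist (blinfun_of_clinfun f) (blinfun_of_clinfun g) = dist f g"
  unfolding dist_norm by transfer simp

instance clinfun :: (complex_normed_vector, complex_banach) complex_banach
proof
  fix X :: "nat \<Rightarrow> ('a, 'b) clinfun"
  assume "Cauchy X"
  then have "Cauchy (\<lambda>n. blinfun_of_clinfun (X n))"
    by (simp add: Cauchy_def dist_blinfun_of_clinfun)
  then obtain L where L: "(\<lambda>n. blinfun_of_clinfun (X n)) \<longlonglongrightarrow> L"
    by (auto simp: Cauchy_convergent_iff convergent_def)
  have pt: "(\<lambda>n. clinfun_apply (X n) x) \<longlonglongrightarrow> blinfun_apply L x" for x
    using blinfun.tendsto[OF L tendsto_const[of x]] by (simp add: blinfun_of_clinfun.rep_eq)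
  have "blinfun_apply L (c *\<^sub>C x) = c *\<^sub>C blinfun_apply L x" for c x
  proof (rule LIMSEQ_unique[OF pt])
    have "(\<lambda>n. c *\<^sub>C clinfun_apply (X n) x) \<longlonglongrightarrow> c *\<^sub>C blinfun_apply L x"
      by (rule bounded_linear.tendsto[OF bounded_linear_scaleC_right pt])
    then show "(\<lambda>n. clinfun_apply (X n) (c *\<^sub>C x)) \<longlonglongrightarrow> c *\<^sub>C blinfun_apply L x"
      using clinfun_apply[of "X _"] by simp
  qed
  then have "blinfun_apply (blinfun_of_clinfun (CLinfun (blinfun_apply L))) = blinfun_apply L"
    by (simp add: blinfun_of_clinfun.rep_eq CLinfun_inverse blinfun.bounded_linear_right)
  then have "blinfun_of_clinfun (CLinfun (blinfun_apply L)) = L"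
    by (simp add: blinfun_apply_inject)
  then have "X \<longlonglongrightarrow> CLinfun (blinfun_apply L)"
    using L by (metis (no_types, lifting) dist_blinfun_of_clinfun lim_sequentially)
  then show "convergent X" by (auto simp: convergent_def)
qed

type_synonym 'a cdual = "('a, complex) clinfun"

definition schauder_basis :: "(nat \<Rightarrow> 'a::complex_banach) \<Rightarrow> bool"
  where "schauder_basis e \<longleftrightarrow> (\<forall>x. \<exists>!c :: nat \<Rightarrow> complex. (\<lambda>n. c n *\<^sub>C e n) sums x)"

section \<open>Holomorphic maps on the open unit ball\<close>

definition has_cderiv ::
  "('a::complex_banach \<Rightarrow> 'b::complex_banach) \<Rightarrow> ('a, 'b) clinfun \<Rightarrow> 'a \<Rightarrow> bool"
  where "has_cderiv f D x \<longleftrightarrow> (f has_derivative clinfun_apply D) (at x)"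

definition cdifferential ::
  "('a::complex_banach \<Rightarrow> 'b::complex_banach) \<Rightarrow> 'a \<Rightarrow> ('a, 'b) clinfun"
  where "cdifferential f x = (THE D. has_cderiv f D x)"

definition holo_ball :: "('a::complex_banach \<Rightarrow> 'b::complex_banach) \<Rightarrow> bool"
  where "holo_ball f \<longleftrightarrow> (\<forall>x\<in>ball 0 1. \<exists>D. has_cderiv f D x)"

text \<open>
  A map defined on the open unit ball is represented by its extension by zero to the whole
  space, so that equality of elements of the function spaces below is equality on the ball.
\<close>

definition zero_off_ball :: "('a::complex_banach \<Rightarrow> 'b::complex_banach) \<Rightarrow> bool"
  where "zero_off_ball f \<longleftrightarrow> (\<forall>x. x \<notin> ball 0 1 \<longrightarrow> f x = 0)"

definition Hinf :: "('a::complex_banach \<Rightarrow> 'b::complex_banach) set"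
  where "Hinf = {f. zero_off_ball f \<and> holo_ball f \<and> bounded (f ` ball 0 1)}"

definition Hinf_norm :: "('a::complex_banach \<Rightarrow> 'b::complex_banach) \<Rightarrow> real"
  where "Hinf_norm f = (SUP x\<in>ball 0 1. norm (f x))"

definition HL0 :: "('a::complex_banach \<Rightarrow> complex) set"
  where "HL0 = {f \<in> Hinf. (\<exists>C. C-lipschitz_on (ball 0 1) f) \<and> f 0 = 0}"

text \<open>The supremum is over a nonempty set as soon as the space is not trivial.\<close>

definition Lip_norm :: "('a::complex_banach \<Rightarrow> complex) \<Rightarrow> real"
  where "Lip_norm f =
    Sup {cmod (f x - f y) / norm (x - y) | x y. x \<in> ball 0 1 \<and> y \<in> ball 0 1 \<and> x \<noteq> y}"

text \<open>The function written as $x \circ g$, for $g$ with values in a space of linear maps.\<close>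

definition ev_comp ::
  "'a \<Rightarrow> ('u \<Rightarrow> ('a::complex_banach, 'b::complex_banach) clinfun) \<Rightarrow> 'u \<Rightarrow> 'b"
  where "ev_comp x g = (\<lambda>u. clinfun_apply (g u) x)"

definition Hinf_s :: "(nat \<Rightarrow> 'a::complex_banach) \<Rightarrow> ('a \<Rightarrow> 'a cdual) set"
  where "Hinf_s e = {g \<in> Hinf. \<forall>n k. \<forall>u\<in>ball 0 1.
    ev_comp (e k) (cdifferential (ev_comp (e n) g)) u =
    ev_comp (e n) (cdifferential (ev_comp (e k) g)) u}"

definition differential_map :: "('a::complex_banach \<Rightarrow> complex) \<Rightarrow> 'a \<Rightarrow> 'a cdual"
  where "differential_map f = (\<lambda>x. if x \<in> ball 0 1 then cdifferential f x else 0)"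

text \<open>
  Surjective linear isometries between two spaces of functions, each given by its underlying
  set with pointwise operations and a norm.
\<close>

definition isometric_isomorphism ::
  "('a \<Rightarrow> 'b::complex_normed_vector) set \<Rightarrow> (('a \<Rightarrow> 'b) \<Rightarrow> real) \<Rightarrow>
   ('c \<Rightarrow> 'd::complex_normed_vector) set \<Rightarrow> (('c \<Rightarrow> 'd) \<Rightarrow> real) \<Rightarrow>
   (('a \<Rightarrow> 'b) \<Rightarrow> ('c \<Rightarrow> 'd)) \<Rightarrow> bool"
  where "isometric_isomorphism U normU V normV T \<longleftrightarrow>
    (\<forall>f\<in>U. \<forall>g\<in>U. T (\<lambda>x. f x + g x) = (\<lambda>x. T f x + T g x)) \<and>
    (\<forall>c. \<forall>f\<in>U. T (\<lambda>x. c *\<^sub>C f x) = (\<lambda>x. c *\<^sub>C T f x)) \<and>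
    (\<forall>f\<in>U. normV (T f) = normU f) \<and>
    T ` U = V"

end

theory Submission
  imports Defs "HOL-Complex_Analysis.Cauchy_Integral_Formula"
begin

text \<open>
  The mean value inequality on the convex ball gives $L(f) \<le> \<parallel>df\<parallel>$, and difference quotients give
  the converse, so $f \<mapsto> df$ is isometric. What has to be shown is that its range is exactly
  the space defined by the compatibility condition.

  That $df$ is holomorphic with values in the dual, with symmetric second derivative, comes from
  one complex variable. Restricting $f$ to complex lines and applying Cauchy's inequality gives a
  second order Taylor estimate
  $|f(u + h) - f(u) - df(u)(h)| \<le> C M \<parallel>h\<parallel>^2$ whose constant depends only on the radius of a ball
  about $u$ and on a bound $M$ of $f$ there (\<open>Taylor_remainder_bound\<close>). This uniformity
  takes the place of compactness. It shows that locally uniform limits of bounded holomorphic functions are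
  holomorphic, in particular the directional derivatives $x \<mapsto> df(x)(k)$, which are limits of
  difference quotients (\<open>has_cderiv_directional_derivative\<close>). It also shows that a bounded map into
  the dual is holomorphic once its evaluations at all vectors are
  (\<open>has_cderiv_of_weakstar_has_cderiv\<close>). The symmetry of the second derivative comes from the same
  limit of difference quotients, read in two ways (\<open>second_derivative_symmetric\<close>).

  Conversely, the compatibility condition extends by linearity and continuity from basis vectors to
  all vectors, because finite linear combinations of a Schauder basis are dense. So $dg(u)$ is a
  symmetric bilinear form for every $u$, and $g$ is the differential of
  $f(x) = \<integral>_0^1 g(tx)(x) \, dt$ (\<open>has_cderiv_radial_primitive\<close>); a primitive with bounded
  differential is Lipschitz on the ball.
\<close>

section \<open>Bounded complex-linear maps and complex differentials\<close>

lemma bounded_linear_clinfun_apply: "bounded_linear (clinfun_apply f)"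
  using clinfun_apply[of f] by simp

lemma clinfun_apply_scaleC: "clinfun_apply f (c *\<^sub>C x) = c *\<^sub>C clinfun_apply f x"
  using clinfun_apply[of f] by simp

lemmas clinfun_apply_add = linear_add[OF bounded_linear.linear[OF bounded_linear_clinfun_apply]]
  and clinfun_apply_scaleR = linear_scale[OF bounded_linear.linear[OF bounded_linear_clinfun_apply]]
  and clinfun_apply_zero = linear_0[OF bounded_linear.linear[OF bounded_linear_clinfun_apply]]

lemma clinfun_eqI: "(\<And>x. clinfun_apply f x = clinfun_apply g x) \<Longrightarrow> f = g"
  by (metis clinfun_apply_inject ext)

lemma scaleR_clinfun_apply: "clinfun_apply (r *\<^sub>R f) x = r *\<^sub>R clinfun_apply f x"
  by (simp add: scaleR_scaleC scaleC_clinfun.rep_eq)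

lemma norm_clinfun_apply_le: "norm (clinfun_apply f x) \<le> norm f * norm x"
  by transfer (auto intro: onorm)

lemma norm_clinfun_le:
  assumes "0 \<le> b" and "\<And>x. norm (clinfun_apply f x) \<le> b * norm x"
  shows "norm f \<le> b"
  using assms by transfer (auto intro: onorm_bound)

lemma bounded_linear_clinfun_eval: "bounded_linear (\<lambda>f. clinfun_apply f x)"
  by (rule bounded_linear_intro[where K = "norm x"])
    (auto simp: plus_clinfun.rep_eq scaleR_clinfun_apply intro: norm_clinfun_apply_le)

lemma clinfun_exists:
  fixes f :: "'a::complex_normed_vector \<Rightarrow> 'b::complex_normed_vector"
  assumes "\<And>x y. f (x + y) = f x + f y" and "\<And>c x. f (c *\<^sub>C x) = c *\<^sub>C f x"
    and "\<And>x. norm (f x) \<le> K * norm x"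
  shows "\<exists>F. clinfun_apply F = f"
proof -
  have "bounded_linear f"
    by (rule bounded_linear_intro[where K = K]) (use assms in \<open>auto simp: scaleR_scaleC mult.commute\<close>)
  then show ?thesis
    using assms CLinfun_inverse[of f] by blast
qed

lemma has_cderiv_unique: "has_cderiv f D x \<Longrightarrow> has_cderiv f E x \<Longrightarrow> D = E"
  unfolding has_cderiv_def
  by (metis has_derivative_unique clinfun_apply_inject)

lemma cdifferential_eqI: "has_cderiv f D x \<Longrightarrow> cdifferential f x = D"
  unfolding cdifferential_def by (rule the_equality) (auto intro: has_cderiv_unique)

lemma has_cderiv_add:
  "has_cderiv f D x \<Longrightarrow> has_cderiv g E x \<Longrightarrow> has_cderiv (\<lambda>x. f x + g x) (D + E) x"
  unfolding has_cderiv_def plus_clinfun.rep_eq by (rule has_derivative_add)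

lemma has_cderiv_diff:
  "has_cderiv f D x \<Longrightarrow> has_cderiv g E x \<Longrightarrow> has_cderiv (\<lambda>x. f x - g x) (D - E) x"
  unfolding has_cderiv_def minus_clinfun.rep_eq by (rule has_derivative_diff)

lemma has_cderiv_scaleC:
  "has_cderiv f D x \<Longrightarrow> has_cderiv (\<lambda>x. c *\<^sub>C f x) (c *\<^sub>C D) x"
  unfolding has_cderiv_def scaleC_clinfun.rep_eq
  by (rule bounded_linear.has_derivative[OF bounded_linear_scaleC_right])

lemma has_cderiv_scaleR:
  "has_cderiv f D x \<Longrightarrow> has_cderiv (\<lambda>x. c *\<^sub>R f x) (c *\<^sub>R D) x"
  unfolding scaleR_scaleC by (rule has_cderiv_scaleC)

lemma has_cderiv_shift:
  assumes "has_cderiv f D (x + c)"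
  shows "has_cderiv (\<lambda>x. f (x + c)) D x"
proof -
  have "((\<lambda>x. x + c) has_derivative (\<lambda>h. h)) (at x)"
    by (auto intro!: derivative_eq_intros)
  from has_derivative_compose[OF this] show ?thesis
    using assms unfolding has_cderiv_def by blast
qed

lemma has_cderiv_transform_open:
  assumes "has_cderiv f D x" "open S" "x \<in> S" "\<And>y. y \<in> S \<Longrightarrow> f y = g y"
  shows "has_cderiv g D x"
  using assms unfolding has_cderiv_def by (rule has_derivative_transform_within_open)

text \<open>
  A bound $C \<parallel>h\<parallel>^2$ with uniform $C$ passes to pointwise limits, to suprema over functionals and to
  integrals over a parameter, while the $o(\<parallel>h\<parallel>)$ of the definition does not. This is why
  differentiability is derived below from remainders of order two.
\<close>
lemma has_derivative_of_quadratic_remainder: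
  fixes f :: "'a::real_normed_vector \<Rightarrow> 'b::real_normed_vector"
  assumes "bounded_linear L" "0 < d"
    and "\<And>h. norm h \<le> d \<Longrightarrow> norm (f (x + h) - f x - L h) \<le> C * (norm h)\<^sup>2"
  shows "(f has_derivative L) (at x)"
proof (rule has_derivativeI_sandwich[OF \<open>0 < d\<close> assms(1), where H = "\<lambda>y. C * norm (y - x)"])
  fix y assume y: "y \<noteq> x" "dist y x < d"
  then have "norm (f y - f x - L (y - x)) \<le> C * (norm (y - x))\<^sup>2"
    using assms(3)[of "y - x"] by (simp add: dist_norm)
  then show "norm (f y - f x - L (y - x)) / norm (y - x) \<le> C * norm (y - x)"
    using y by (simp add: field_simps power2_eq_square)
next
  have "((\<lambda>y. C * norm (y - x)) \<longlongrightarrow> C * norm (x - x)) (at x)"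
    by (intro tendsto_intros)
  then show "((\<lambda>y. C * norm (y - x)) \<longlongrightarrow> 0) (at x)" by simp
qed

section \<open>Cauchy and Taylor estimates along complex lines\<close>

text \<open>
  Cauchy's inequality bounds $\<phi>'$ at the centre and $\<phi>''$ on the disc of half the radius, and the
  latter bounds the first order Taylor remainder there.
\<close>
lemma holomorphic_disc_estimates:
  assumes holo: "\<phi> holomorphic_on ball 0 R" and M: "\<And>z. z \<in> ball 0 R \<Longrightarrow> cmod (\<phi> z) \<le> M"
    and R: "0 < R"
  shows "cmod (deriv \<phi> 0) \<le> 2 * M / R"
    and "cmod z \<le> R / 2 \<Longrightarrow> cmod (\<phi> z - \<phi> 0 - deriv \<phi> 0 * z) \<le> 32 * M * (cmod z / R)\<^sup>2"
proof -
  have bound: "cmod ((deriv ^^ n) \<phi> w) \<le> fact n * M / s ^ n" if "0 < s" "cmod w + s < R" for n w s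
  proof (rule Cauchy_inequality)
    have sub: "cball w s \<subseteq> ball 0 R"
    proof
      fix y assume "y \<in> cball w s"
      then show "y \<in> ball 0 R"
        using that norm_triangle_ineq[of w "y - w"] by (simp add: dist_norm norm_minus_commute)
    qed
    show "\<phi> holomorphic_on ball w s" "continuous_on (cball w s) \<phi>"
      using sub holomorphic_on_subset[OF holo] holomorphic_on_imp_continuous_on ball_subset_cball
      by blast+
    show "cmod (\<phi> y) \<le> M" if "cmod (w - y) = s" for y
      using sub M that by (auto simp: dist_norm subset_iff)
  qed fact
  show "cmod (deriv \<phi> 0) \<le> 2 * M / R"
    using bound[of "R / 2" 0 1] R by (simp add: field_simps)
  assume z: "cmod z \<le> R / 2"
  \<comment> \<open>A disc of radius $R/4$ about a point of the disc of radius $R/2$ stays inside the domain;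
      Cauchy gives $2M/(R/4)^2 = 32M/R^2$.\<close>
  have "cmod ((deriv ^^ 0) \<phi> z - (\<Sum>i\<le>1. (deriv ^^ i) \<phi> 0 * (z - 0) ^ i / fact i))
      \<le> 32 * M / R\<^sup>2 * cmod (z - 0) ^ Suc 1 / fact 1"
  proof (rule complex_Taylor[where S = "cball 0 (R / 2)"])
    fix i :: nat and w :: complex assume w: "w \<in> cball 0 (R / 2)"
    then have "(deriv ^^ i) \<phi> holomorphic_on ball 0 R" "w \<in> ball 0 R"
      using R by (auto intro!: holomorphic_higher_deriv holo)
    then have "((deriv ^^ i) \<phi> has_field_derivative (deriv ^^ Suc i) \<phi> w) (at w)"
      by (simp add: holomorphic_derivI)
    then show "((deriv ^^ i) \<phi> has_field_derivative (deriv ^^ Suc i) \<phi> w) (at w within cball 0 (R / 2))"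
      by (rule has_field_derivative_at_within)
  next
    fix w :: complex assume "w \<in> cball 0 (R / 2)"
    then show "cmod ((deriv ^^ Suc 1) \<phi> w) \<le> 32 * M / R\<^sup>2"
      using bound[of "R / 4" w 2] R by (simp add: numeral_2_eq_2 power2_eq_square field_simps)
  qed (use z R in auto)
  then show "cmod (\<phi> z - \<phi> 0 - deriv \<phi> 0 * z) \<le> 32 * M * (cmod z / R)\<^sup>2"
    by (simp add: power_divide power2_eq_square algebra_simps)
qed

text \<open>
  The one-variable estimates, applied to $z \<mapsto> f(u + zh)$ on the disc of radius
  $r / \<parallel>h\<parallel>$. The bounds contain $f$ only through $M$ and $h$ only through its norm, and this uniformity
  is what carries the arguments over to infinite dimension, where balls are not compact.
\<close>
lemma
  fixes f :: "'a::complex_banach \<Rightarrow> complex"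
  assumes r: "0 < r" and D: "\<And>x. x \<in> ball u r \<Longrightarrow> has_cderiv f (D x) x"
    and M: "\<And>x. x \<in> ball u r \<Longrightarrow> cmod (f x) \<le> M"
  shows Cauchy_estimate: "cmod (clinfun_apply (D u) h) \<le> 2 * M / r * norm h"
    and Taylor_remainder_bound:
      "norm h \<le> r / 2 \<Longrightarrow> cmod (f (u + h) - f u - clinfun_apply (D u) h) \<le> 32 * M * (norm h / r)\<^sup>2"
proof -
  have M0: "0 \<le> M" using M[of u] r by (smt (verit) centre_in_ball norm_ge_zero)
  define R where "R = r / norm h"
  define \<phi> where "\<phi> = (\<lambda>z. f (u + z *\<^sub>C h))"
  have "cmod (clinfun_apply (D u) h) \<le> 2 * M / r * norm h \<and>
    (norm h \<le> r / 2 \<longrightarrow> cmod (f (u + h) - f u - clinfun_apply (D u) h) \<le> 32 * M * (norm h / r)\<^sup>2)"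
  proof (cases "h = 0")
    case True
    then show ?thesis by (simp add: clinfun_apply_zero)
  next
    case False
    then have R: "0 < R" using r by (simp add: R_def)
    have mem: "u + z *\<^sub>C h \<in> ball u r" if "z \<in> ball 0 R" for z
      using that False by (simp add: dist_norm norm_scaleC R_def field_simps)
    have der: "(\<phi> has_field_derivative clinfun_apply (D (u + z *\<^sub>C h)) h) (at z)" if "z \<in> ball 0 R" for z
    proof -
      have "bounded_linear (\<lambda>z::complex. z *\<^sub>C h)"
        by (rule bounded_linear_intro[where K = "norm h"])
          (auto simp: scaleC_add_left norm_scaleC scaleR_scaleC scaleC_scaleC scaleC_complex_def)
      then have "((\<lambda>z. u + z *\<^sub>C h) has_derivative (\<lambda>z. z *\<^sub>C h)) (at z)"
        by (auto intro!: derivative_eq_intros bounded_linear_imp_has_derivative)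
      from has_derivative_compose[OF this D[OF mem[OF that], unfolded has_cderiv_def]]
      show ?thesis
        by (simp add: \<phi>_def has_field_derivative_def clinfun_apply_scaleC scaleC_complex_def
            mult_commute_abs)
    qed
    then have holo: "\<phi> holomorphic_on ball 0 R"
      by (meson has_field_derivative_at_within holomorphic_on_def field_differentiable_def)
    have z0: "0 *\<^sub>C h = 0" and z1: "1 *\<^sub>C h = h"
      using scaleR_scaleC[of 0 h] scaleR_scaleC[of 1 h] by simp_all
    have d0: "deriv \<phi> 0 = clinfun_apply (D u) h"
      using der[of 0] R by (simp add: DERIV_imp_deriv z0)
    have bd: "cmod (\<phi> z) \<le> M" if "z \<in> ball 0 R" for z
      using M[OF mem[OF that]] by (simp add: \<phi>_def)
    show ?thesis
      using holomorphic_disc_estimates(1)[OF holo bd R, unfolded d0]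
        holomorphic_disc_estimates(2)[OF holo bd R, of 1, unfolded d0] False r
      by (auto simp: \<phi>_def z0 z1 R_def field_simps)
  qed
  then show "cmod (clinfun_apply (D u) h) \<le> 2 * M / r * norm h"
    and "norm h \<le> r / 2 \<Longrightarrow> cmod (f (u + h) - f u - clinfun_apply (D u) h) \<le> 32 * M * (norm h / r)\<^sup>2"
    by blast+
qed

lemma local_Lipschitz_bound:
  fixes f :: "'a::complex_banach \<Rightarrow> complex"
  assumes r: "0 < r" and D: "\<And>x. x \<in> ball u r \<Longrightarrow> has_cderiv f (D x) x"
    and M: "\<And>x. x \<in> ball u r \<Longrightarrow> cmod (f x) \<le> M" and h: "norm h \<le> r / 2"
  shows "cmod (f (u + h) - f u) \<le> 18 * M / r * norm h"
proof -
  have M0: "0 \<le> M" using M[of u] r by (smt (verit) centre_in_ball norm_ge_zero)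
  have "cmod (f (u + h) - f u) \<le> 32 * M * (norm h / r)\<^sup>2 + 2 * M / r * norm h"
    using norm_triangle_ineq[of "f (u + h) - f u - clinfun_apply (D u) h" "clinfun_apply (D u) h"]
      Cauchy_estimate[of r u f D M h, OF r D M] Taylor_remainder_bound[of r u f D M h, OF r D M h] by simp
  \<comment> \<open>One factor of the square is at most $1/2$, so the two terms add up to $18 M \<parallel>h\<parallel> / r$.\<close>
  also have "32 * M * (norm h / r)\<^sup>2 \<le> 32 * M * (norm h / r * (1 / 2))"
    unfolding power2_eq_square
    using M0 r h by (intro mult_left_mono) (auto simp: field_simps)
  finally show ?thesis by (simp add: field_simps)
qed

section \<open>Differentials of holomorphic functions are holomorphic\<close>

text \<open>
  Weierstrass' theorem, with convergence of the differentials in operator norm. They form a Cauchy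
  sequence by the Cauchy estimate for the differences $F_m - F_n$, and the common bound $K$ makes
  the Taylor remainders of the $F_n$ quadratically small with a constant free of $n$, so the
  remainder of the limit is too.
\<close>
lemma has_cderiv_of_uniform_limit:
  fixes F :: "nat \<Rightarrow> 'a::complex_banach \<Rightarrow> complex"
  assumes r: "0 < r" and E: "\<And>n x. x \<in> ball u r \<Longrightarrow> has_cderiv (F n) (E n x) x"
    and lim: "uniform_limit (ball u r) F f sequentially"
    and K: "\<And>n x. x \<in> ball u r \<Longrightarrow> cmod (F n x) \<le> K"
  shows "\<exists>D. has_cderiv f D u \<and> (\<lambda>n. E n u) \<longlonglongrightarrow> D"
proof -
  have "Cauchy (\<lambda>n. E n u)"
  proof (rule metric_CauchyI)
    fix \<epsilon> :: real assume \<epsilon>: "0 < \<epsilon>"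
    \<comment> \<open>The Cauchy estimate turns the tolerance $\<epsilon> r / 4$ into $\<epsilon> / 2$ for the differentials.\<close>
    then have "0 < \<epsilon> * r / 4" using r by simp
    then obtain N where N: "\<And>m n x. m \<ge> N \<Longrightarrow> n \<ge> N \<Longrightarrow> x \<in> ball u r \<Longrightarrow> dist (F m x) (F n x) < \<epsilon> * r / 4"
      using uniformly_convergent_Cauchy[OF uniformly_convergentI[OF lim]]
      unfolding uniformly_Cauchy_on_def by meson
    have "dist (E m u) (E n u) < \<epsilon>" if "m \<ge> N" "n \<ge> N" for m n
    proof -
      have "cmod (clinfun_apply (E m u - E n u) h) \<le> 2 * (\<epsilon> * r / 4) / r * norm h" for h
      proof (rule Cauchy_estimate[where f = "\<lambda>x. F m x - F n x" and D = "\<lambda>x. E m x - E n x", OF r])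
        show "cmod (F m x - F n x) \<le> \<epsilon> * r / 4" if "x \<in> ball u r" for x
          using N[OF \<open>m \<ge> N\<close> \<open>n \<ge> N\<close> that] by (simp add: dist_norm)
      qed (intro has_cderiv_diff E)
      then have "norm (E m u - E n u) \<le> \<epsilon> / 2"
        using \<epsilon> r by (intro norm_clinfun_le) auto
      then show ?thesis using \<epsilon> by (simp add: dist_norm)
    qed
    then show "\<exists>M. \<forall>m\<ge>M. \<forall>n\<ge>M. dist (E m u) (E n u) < \<epsilon>" by blast
  qed
  then obtain D where D: "(\<lambda>n. E n u) \<longlonglongrightarrow> D"
    by (auto simp: Cauchy_convergent_iff convergent_def)
  have pt: "(\<lambda>n. F n x) \<longlonglongrightarrow> f x" if "x \<in> ball u r" for x
    by (rule tendsto_uniform_limitI[OF lim that])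
  have "has_cderiv f D u"
    unfolding has_cderiv_def
  proof (rule has_derivative_of_quadratic_remainder[OF bounded_linear_clinfun_apply])
    show "0 < r / 2" using r by simp
    fix h :: 'a assume h: "norm h \<le> r / 2"
    have "(\<lambda>n. cmod (F n (u + h) - F n u - clinfun_apply (E n u) h))
        \<longlonglongrightarrow> cmod (f (u + h) - f u - clinfun_apply D h)"
      using h r by (intro tendsto_intros pt bounded_linear.tendsto[OF bounded_linear_clinfun_eval D])
        (auto simp: dist_norm)
    moreover have "cmod (F n (u + h) - F n u - clinfun_apply (E n u) h) \<le> 32 * K * (norm h / r)\<^sup>2" for n
      by (rule Taylor_remainder_bound[OF r _ _ h]) (auto intro: E K)
    ultimately have "cmod (f (u + h) - f u - clinfun_apply D h) \<le> 32 * K * (norm h / r)\<^sup>2"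
      by (intro Lim_bounded) auto
    then show "cmod (f (u + h) - f u - clinfun_apply D h) \<le> 32 * K / r\<^sup>2 * (norm h)\<^sup>2"
      by (simp add: power_divide)
  qed
  with D show ?thesis by blast
qed

text \<open>
  A locally bounded map into a dual that is holomorphic when evaluated at each vector $k$ is
  holomorphic in norm. By linearity in $k$ the differentials of the functions $k \<circ> g$ form a
  bilinear map in $h$ and $k$, which is the candidate for the differential of $g$. The norm in the
  dual is a supremum over $k$ of scalar absolute values, and the Taylor remainder of $k \<circ> g$ is
  bounded by a multiple of $\<parallel>k\<parallel>$.
\<close>
lemma has_cderiv_of_weakstar_has_cderiv:
  fixes g :: "'a::complex_banach \<Rightarrow> ('b::complex_banach) cdual"
  assumes r: "0 < r" and G: "\<And>k x. x \<in> ball u r \<Longrightarrow> has_cderiv (ev_comp k g) (G k x) x"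
    and M: "\<And>x. x \<in> ball u r \<Longrightarrow> norm (g x) \<le> M"
  shows "\<exists>D. has_cderiv g D u \<and> (\<forall>h k. clinfun_apply (clinfun_apply D h) k = clinfun_apply (G k u) h)"
proof -
  have u: "u \<in> ball u r" using r by simp
  have M0: "0 \<le> M" using M[OF u] norm_ge_zero order_trans by blast
  have Mk: "cmod (ev_comp k g x) \<le> M * norm k" if "x \<in> ball u r" for k x
    unfolding ev_comp_def
    using norm_clinfun_apply_le[of "g x" k] M[OF that] mult_right_mono[of "norm (g x)" M "norm k"] by simp
  have bound: "cmod (clinfun_apply (G k u) h) \<le> 2 * M / r * norm h * norm k" for h k
    using Cauchy_estimate[of r u "ev_comp k g" "G k" "M * norm k" h] r G Mk by (simp add: mult_ac)
  have add: "G (k + k') u = G k u + G k' u" for k k'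
  proof (rule has_cderiv_unique[OF G[OF u]])
    have "ev_comp (k + k') g = (\<lambda>x. ev_comp k g x + ev_comp k' g x)"
      by (simp add: ev_comp_def clinfun_apply_add)
    then show "has_cderiv (ev_comp (k + k') g) (G k u + G k' u) u"
      using has_cderiv_add[OF G[OF u] G[OF u]] by simp
  qed
  have scale: "G (c *\<^sub>C k) u = c *\<^sub>C G k u" for c k
  proof (rule has_cderiv_unique[OF G[OF u]])
    have "ev_comp (c *\<^sub>C k) g = (\<lambda>x. c *\<^sub>C ev_comp k g x)"
      by (simp add: ev_comp_def clinfun_apply_scaleC)
    then show "has_cderiv (ev_comp (c *\<^sub>C k) g) (c *\<^sub>C G k u) u"
      using has_cderiv_scaleC[OF G[OF u]] by simp
  qed
  have "\<exists>F :: 'b cdual. clinfun_apply F = (\<lambda>k. clinfun_apply (G k u) h)" for h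
    by (rule clinfun_exists[where K = "2 * M / r * norm h"])
      (auto simp: add scale plus_clinfun.rep_eq scaleC_clinfun.rep_eq intro: order_trans[OF bound])
  then obtain L :: "'a \<Rightarrow> 'b cdual" where L: "\<And>h k. clinfun_apply (L h) k = clinfun_apply (G k u) h"
    by metis
  have "\<exists>D. clinfun_apply D = L"
  proof (rule clinfun_exists[where K = "2 * M / r"])
    show "norm (L h) \<le> 2 * M / r * norm h" for h
      using M0 r by (intro norm_clinfun_le) (auto simp: L intro: order_trans[OF bound])
  qed (auto intro!: clinfun_eqI
      simp: L plus_clinfun.rep_eq scaleC_clinfun.rep_eq clinfun_apply_add clinfun_apply_scaleC)
  then obtain D where D: "clinfun_apply D = L" by blast
  have "has_cderiv g D u"
    unfolding has_cderiv_def
  proof (rule has_derivative_of_quadratic_remainder[OF bounded_linear_clinfun_apply])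
    show "0 < r / 2" using r by simp
    fix h :: 'a assume h: "norm h \<le> r / 2"
    show "norm (g (u + h) - g u - clinfun_apply D h) \<le> 32 * M / r\<^sup>2 * (norm h)\<^sup>2"
    proof (rule norm_clinfun_le)
      fix k
      have "cmod (ev_comp k g (u + h) - ev_comp k g u - clinfun_apply (G k u) h)
          \<le> 32 * (M * norm k) * (norm h / r)\<^sup>2"
        by (rule Taylor_remainder_bound[OF r _ _ h]) (auto intro: G Mk)
      then show "norm (clinfun_apply (g (u + h) - g u - clinfun_apply D h) k)
          \<le> 32 * M / r\<^sup>2 * (norm h)\<^sup>2 * norm k"
        by (simp add: ev_comp_def minus_clinfun.rep_eq D L power_divide mult_ac)
    qed (use M0 in simp)
  qed
  then show ?thesis using D L by auto
qed

text \<open>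
  The directional derivative $x \<mapsto> df(x)(k)$ is by the Taylor estimate a uniform limit of the
  difference quotients $(f(x + \<delta>_n k) - f(x)) / \<delta>_n$, hence holomorphic. The last conjunct
  records that its differential $E$ is the limit of the differentials of the quotients: it
  exhibits $E$ also as a derivative of $df$ in direction $k$, and so gives the symmetry of
  second derivatives.
\<close>
lemma has_cderiv_directional_derivative:
  fixes f :: "'a::complex_banach \<Rightarrow> complex"
  assumes r: "0 < r" and D: "\<And>x. x \<in> ball u r \<Longrightarrow> has_cderiv f (D x) x"
    and M: "\<And>x. x \<in> ball u r \<Longrightarrow> cmod (f x) \<le> M"
  shows "\<exists>E \<delta>. has_cderiv (\<lambda>x. clinfun_apply (D x) k) E u \<and> (\<forall>n. 0 < \<delta> n) \<and> \<delta> \<longlonglongrightarrow> 0 \<and>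
    (\<lambda>n. (1 / \<delta> n) *\<^sub>R (D (u + \<delta> n *\<^sub>R k) - D u)) \<longlonglongrightarrow> E"
proof -
  have M0: "0 \<le> M" using M[of u] r by (smt (verit) centre_in_ball norm_ge_zero)
  \<comment> \<open>The estimates are used on balls of radius $r/2$ about points of the ball
      of radius $r/2$, so the steps must satisfy $\<delta>_n \<parallel>k\<parallel> \<le> r/4$; adding $1$ covers the case $k = 0$.\<close>
  define s where "s = r / 4 / (1 + norm k)"
  have pos: "0 < 1 + norm k" by (smt (verit) norm_ge_zero)
  have s: "0 < s" "s * norm k \<le> r / 4"
    using r pos by (auto simp: s_def field_simps)
  define \<delta> where "\<delta> n = s * inverse (real (Suc n))" for n
  have \<delta>0: "0 < \<delta> n" for n using s by (simp add: \<delta>_def)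
  have \<delta>lim: "\<delta> \<longlonglongrightarrow> 0"
    unfolding \<delta>_def by (rule tendsto_mult_right_zero[OF LIMSEQ_inverse_real_of_nat])
  have "\<delta> n \<le> s" for n
    using s mult_left_mono[of "inverse (real (Suc n))" 1 s] by (simp add: \<delta>_def inverse_le_1_iff)
  then have small: "norm (\<delta> n *\<^sub>R k) \<le> r / 2 / 2" for n
    using s \<delta>0[of n] mult_right_mono[of "\<delta> n" s "norm k"] by simp
  have sub: "y \<in> ball u r" if "x \<in> ball u (r / 2)" "y \<in> ball x (r / 2)" for x y
    using that dist_triangle_lt[of u x y r] by (simp add: dist_commute)
  define F where "F n x = (1 / \<delta> n) *\<^sub>R (f (x + \<delta> n *\<^sub>R k) - f x)" for n x
  define E where "E n x = (1 / \<delta> n) *\<^sub>R (D (x + \<delta> n *\<^sub>R k) - D x)" for n x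
  have "\<exists>E'. has_cderiv (\<lambda>x. clinfun_apply (D x) k) E' u \<and> (\<lambda>n. E n u) \<longlonglongrightarrow> E'"
  proof (rule has_cderiv_of_uniform_limit)
    show "0 < r / 2" using r by simp
    show "has_cderiv (F n) (E n x) x" if x: "x \<in> ball u (r / 2)" for n x
    proof -
      have "x + \<delta> n *\<^sub>R k \<in> ball x (r / 2)" using small[of n] r by (simp add: dist_norm)
      then have "x + \<delta> n *\<^sub>R k \<in> ball u r" "x \<in> ball u r" using sub x r by auto
      then show ?thesis
        unfolding F_def E_def by (intro has_cderiv_scaleR has_cderiv_diff has_cderiv_shift D)
    qed
    show "cmod (F n x) \<le> 18 * M / (r / 2) * norm k" if x: "x \<in> ball u (r / 2)" for n x
    proof -
      have "cmod (f (x + \<delta> n *\<^sub>R k) - f x) \<le> 18 * M / (r / 2) * norm (\<delta> n *\<^sub>R k)"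
        by (rule local_Lipschitz_bound[OF _ _ _ small]) (use r sub[OF x] D M in auto)
      then show ?thesis
        using \<delta>0[of n] unfolding F_def norm_scaleR by (simp add: pos_divide_le_eq mult_ac)
    qed
    show "uniform_limit (ball u (r / 2)) F (\<lambda>x. clinfun_apply (D x) k) sequentially"
    proof (rule uniform_limitI)
      fix \<epsilon> :: real assume \<epsilon>: "0 < \<epsilon>"
      define C where "C = 32 * M * (norm k / (r / 2))\<^sup>2"
      have "(\<lambda>n. C * \<delta> n) \<longlonglongrightarrow> 0" by (rule tendsto_mult_right_zero[OF \<delta>lim])
      then have "\<forall>\<^sub>F n in sequentially. C * \<delta> n < \<epsilon>" using \<epsilon> by (rule order_tendstoD)
      then show "\<forall>\<^sub>F n in sequentially. \<forall>x\<in>ball u (r / 2). dist (F n x) (clinfun_apply (D x) k) < \<epsilon>"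
      proof eventually_elim
        case (elim n)
        show ?case
        proof
          fix x assume x: "x \<in> ball u (r / 2)"
          have "cmod (f (x + \<delta> n *\<^sub>R k) - f x - clinfun_apply (D x) (\<delta> n *\<^sub>R k))
              \<le> 32 * M * (norm (\<delta> n *\<^sub>R k) / (r / 2))\<^sup>2"
            by (rule Taylor_remainder_bound[OF _ _ _ small]) (use r sub[OF x] D M in auto)
          also have "\<dots> = \<delta> n * (C * \<delta> n)"
            using \<delta>0[of n] by (simp add: C_def power2_eq_square)
          finally have "\<bar>1 / \<delta> n\<bar> * cmod (f (x + \<delta> n *\<^sub>R k) - f x - clinfun_apply (D x) (\<delta> n *\<^sub>R k))
              \<le> C * \<delta> n"
            using \<delta>0[of n] by (simp add: field_simps)
          also have "\<bar>1 / \<delta> n\<bar> * cmod (f (x + \<delta> n *\<^sub>R k) - f x - clinfun_apply (D x) (\<delta> n *\<^sub>R k))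
              = cmod ((1 / \<delta> n) *\<^sub>R (f (x + \<delta> n *\<^sub>R k) - f x - \<delta> n *\<^sub>R clinfun_apply (D x) k))"
            by (simp only: norm_scaleR clinfun_apply_scaleR)
          also have "(1 / \<delta> n) *\<^sub>R (f (x + \<delta> n *\<^sub>R k) - f x - \<delta> n *\<^sub>R clinfun_apply (D x) k)
              = F n x - clinfun_apply (D x) k"
            using \<delta>0[of n] by (simp add: F_def scaleR_diff_right)
          finally show "dist (F n x) (clinfun_apply (D x) k) < \<epsilon>"
            using elim by (simp add: dist_norm)
        qed
      qed
    qed
  qed
  then show ?thesis using \<delta>0 \<delta>lim unfolding E_def by blast
qed

lemma has_derivative_directional_limit:
  assumes "(f has_derivative D) (at u)" "\<And>n. 0 < \<delta> n" "\<delta> \<longlonglongrightarrow> (0::real)"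
  shows "(\<lambda>n. (1 / \<delta> n) *\<^sub>R (f (u + \<delta> n *\<^sub>R k) - f u)) \<longlonglongrightarrow> D k"
proof -
  have "((\<lambda>t. u + t *\<^sub>R k) has_derivative (\<lambda>t. t *\<^sub>R k)) (at 0)"
    by (auto intro!: derivative_eq_intros)
  from has_derivative_compose[OF this, of f D] assms(1)
  have "((\<lambda>t. f (u + t *\<^sub>R k)) has_derivative (\<lambda>t. D (t *\<^sub>R k))) (at 0)" by simp
  then have "(\<lambda>t. norm (f (u + t *\<^sub>R k) - f u - D (t *\<^sub>R k)) / \<bar>t\<bar>) \<midarrow>0\<rightarrow> 0"
    by (simp add: has_derivative_at)
  moreover have "filterlim \<delta> (at 0) sequentially"
    using assms(2,3) by (auto simp: filterlim_at less_imp_neq[symmetric])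
  ultimately have "(\<lambda>n. norm (f (u + \<delta> n *\<^sub>R k) - f u - D (\<delta> n *\<^sub>R k)) / \<bar>\<delta> n\<bar>) \<longlonglongrightarrow> 0"
    by (rule filterlim_compose)
  moreover have "norm (f (u + \<delta> n *\<^sub>R k) - f u - D (\<delta> n *\<^sub>R k)) / \<bar>\<delta> n\<bar>
      = norm ((1 / \<delta> n) *\<^sub>R (f (u + \<delta> n *\<^sub>R k) - f u) - D k)" for n
  proof -
    have "norm (f (u + \<delta> n *\<^sub>R k) - f u - D (\<delta> n *\<^sub>R k)) / \<bar>\<delta> n\<bar>
        = norm ((1 / \<delta> n) *\<^sub>R (f (u + \<delta> n *\<^sub>R k) - f u - \<delta> n *\<^sub>R D k))"
      using has_derivative_bounded_linear[OF assms(1)]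
      by (simp add: bounded_linear.linear linear_scale divide_inverse mult.commute)
    also have "(1 / \<delta> n) *\<^sub>R (f (u + \<delta> n *\<^sub>R k) - f u - \<delta> n *\<^sub>R D k)
        = (1 / \<delta> n) *\<^sub>R (f (u + \<delta> n *\<^sub>R k) - f u) - D k"
      using assms(2)[of n] by (simp add: scaleR_diff_right)
    finally show ?thesis .
  qed
  ultimately show ?thesis
    by (simp add: tendsto_norm_zero_iff LIM_zero_iff)
qed

text \<open>
  Both sides are the limit of $(df(u + \<delta>_n k)(h) - df(u)(h)) / \<delta>_n$: the left one because the
  differentials of the difference quotients of $f$ in direction $k$ converge to $E_k$, the right
  one because this is a difference quotient of $x \<mapsto> df(x)(h)$, whose differential is $E_h$.
\<close>
lemma second_derivative_symmetric:
  fixes f :: "'a::complex_banach \<Rightarrow> complex"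
  assumes r: "0 < r" and D: "\<And>x. x \<in> ball u r \<Longrightarrow> has_cderiv f (D x) x"
    and M: "\<And>x. x \<in> ball u r \<Longrightarrow> cmod (f x) \<le> M"
    and E: "\<And>k. has_cderiv (\<lambda>x. clinfun_apply (D x) k) (E k) u"
  shows "clinfun_apply (E k) h = clinfun_apply (E h) k"
proof -
  obtain E' \<delta> where E': "has_cderiv (\<lambda>x. clinfun_apply (D x) k) E' u"
    and \<delta>: "\<And>n. 0 < \<delta> n" "\<delta> \<longlonglongrightarrow> 0"
    and lim: "(\<lambda>n. (1 / \<delta> n) *\<^sub>R (D (u + \<delta> n *\<^sub>R k) - D u)) \<longlonglongrightarrow> E'"
    using has_cderiv_directional_derivative[of r u f D M k] r D M by blast
  have "(\<lambda>n. (1 / \<delta> n) *\<^sub>R (clinfun_apply (D (u + \<delta> n *\<^sub>R k)) h - clinfun_apply (D u) h))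
      \<longlonglongrightarrow> clinfun_apply E' h"
    using bounded_linear.tendsto[OF bounded_linear_clinfun_eval lim, of h]
    by (simp add: scaleR_clinfun_apply minus_clinfun.rep_eq)
  moreover have "(\<lambda>n. (1 / \<delta> n) *\<^sub>R (clinfun_apply (D (u + \<delta> n *\<^sub>R k)) h - clinfun_apply (D u) h))
      \<longlonglongrightarrow> clinfun_apply (E h) k"
    by (rule has_derivative_directional_limit[OF _ \<delta>]) (use E[of h] in \<open>simp add: has_cderiv_def\<close>)
  ultimately have "clinfun_apply E' h = clinfun_apply (E h) k"
    by (rule LIMSEQ_unique)
  then show ?thesis using has_cderiv_unique[OF E' E] by simp
qed

section \<open>Schauder bases\<close>

lemma clinfun_eqI_schauder_basis:
  fixes e :: "nat \<Rightarrow> 'a::complex_banach" and F G :: "('a, 'b::complex_banach) clinfun"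
  assumes "schauder_basis e" and eq: "\<And>n. clinfun_apply F (e n) = clinfun_apply G (e n)"
  shows "F = G"
proof (rule clinfun_eqI)
  fix x
  obtain c where "(\<lambda>n. c n *\<^sub>C e n) sums x"
    using assms(1) unfolding schauder_basis_def by blast
  then have "(\<lambda>n. c n *\<^sub>C clinfun_apply H (e n)) sums clinfun_apply H x" for H :: "('a, 'b) clinfun"
    using bounded_linear.sums[OF bounded_linear_clinfun_apply] by (simp flip: clinfun_apply_scaleC)
  from this[of F] this[of G] show "clinfun_apply F x = clinfun_apply G x"
    by (simp add: eq sums_unique2)
qed

text \<open>
  In the zero space every coefficient sequence represents $0$, so uniqueness fails. Nontriviality
  is needed because over the zero space the supremum in the Lipschitz norm is that of the empty set.
\<close>
lemma schauder_basis_nontrivial: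
  fixes e :: "nat \<Rightarrow> 'a::complex_banach"
  assumes "schauder_basis e"
  shows "\<exists>x :: 'a. x \<noteq> 0"
proof (rule ccontr)
  assume trivial: "\<nexists>x :: 'a. x \<noteq> 0"
  have zero: "c n *\<^sub>C e n = 0" for c :: "nat \<Rightarrow> complex" and n
    by (rule ccontr) (rule notE[OF trivial exI])
  have sums_zero: "(\<lambda>n. c n *\<^sub>C e n) sums 0" for c :: "nat \<Rightarrow> complex"
    unfolding zero by (rule sums_zero)
  have "\<exists>!c :: nat \<Rightarrow> complex. (\<lambda>n. c n *\<^sub>C e n) sums 0"
    using assms unfolding schauder_basis_def by (rule spec)
  then obtain c\<^sub>0 :: "nat \<Rightarrow> complex" where unique: "\<And>c. (\<lambda>n. c n *\<^sub>C e n) sums 0 \<Longrightarrow> c = c\<^sub>0"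
    by (rule ex1E) iprover
  have "(\<lambda>_ :: nat. 0) = (\<lambda>_. 1 :: complex)"
    by (rule trans[OF unique[OF sums_zero] unique[OF sums_zero, symmetric]])
  from fun_cong[OF this] show False by simp
qed

section \<open>Primitives of maps with symmetric differential\<close>

text \<open>
  Stated for \<^const>\<open>cdifferential\<close> so that the condition defining \<^const>\<open>Hinf_s\<close> can be rewritten directly.
\<close>
lemma has_cderiv_ev_comp:
  assumes "has_cderiv g D u"
  shows "has_cderiv (ev_comp k g) (cdifferential (ev_comp k g) u) u"
    and "clinfun_apply (cdifferential (ev_comp k g) u) h = clinfun_apply (clinfun_apply D h) k"
proof -
  have "\<exists>E. clinfun_apply E = (\<lambda>h. clinfun_apply (clinfun_apply D h) k)"
  proof (rule clinfun_exists)
    show "norm (clinfun_apply (clinfun_apply D h) k) \<le> norm D * norm k * norm h" for h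
      using norm_clinfun_apply_le[of "clinfun_apply D h" k]
        mult_right_mono[OF norm_clinfun_apply_le[of D h], of "norm k"] by (simp add: mult_ac)
  qed (auto simp: clinfun_apply_add plus_clinfun.rep_eq clinfun_apply_scaleC scaleC_clinfun.rep_eq)
  then obtain E where E: "clinfun_apply E = (\<lambda>h. clinfun_apply (clinfun_apply D h) k)" by blast
  have "has_cderiv (ev_comp k g) E u"
    using bounded_linear.has_derivative[OF bounded_linear_clinfun_eval assms[unfolded has_cderiv_def]]
    unfolding has_cderiv_def ev_comp_def E .
  then show "has_cderiv (ev_comp k g) (cdifferential (ev_comp k g) u) u"
    and "clinfun_apply (cdifferential (ev_comp k g) u) h = clinfun_apply (clinfun_apply D h) k"
    using cdifferential_eqI[of "ev_comp k g" E u] E by simp_all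
qed

text \<open>
  The Poincare lemma: $f(x) = \<integral>_0^1 g(tx)(x) \, dt$ is a primitive of a map $g$ with symmetric
  differential. The fundamental theorem of calculus, applied to $t \<mapsto> t\,g(tx)(h)$, writes $g(x)(h)$ as an
  integral over the same interval, and with the symmetry the integrand of
  $f(x + h) - f(x) - g(x)(h)$ becomes
  \[ \bigl(g(tx + th)(x) - g(tx)(x) - dg(tx)(th)(x)\bigr) + \bigl(g(tx + th)(h) - g(tx)(h)\bigr). \]
  The Taylor estimate for $x \<circ> g$ and the Lipschitz estimate for $h \<circ> g$ bound it by a
  multiple of $\<parallel>h\<parallel>^2$, uniformly in $t$ since the balls of radius $r$ about the points $tx$
  all lie in the domain.
\<close>
lemma has_cderiv_radial_primitive:
  fixes g :: "'a::complex_banach \<Rightarrow> 'a cdual"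
  assumes r: "0 < r" "norm x + r \<le> R"
    and D: "\<And>u. u \<in> ball 0 R \<Longrightarrow> has_cderiv g (D u) u"
    and M: "\<And>u. u \<in> ball 0 R \<Longrightarrow> norm (g u) \<le> M"
    and sym: "\<And>u h k. u \<in> ball 0 R \<Longrightarrow>
      clinfun_apply (clinfun_apply (D u) h) k = clinfun_apply (clinfun_apply (D u) k) h"
  shows "has_cderiv (\<lambda>x. integral {0..1} (\<lambda>t. clinfun_apply (g (t *\<^sub>R x)) x)) (g x) x"
proof -
  define f where "f = (\<lambda>x. integral {0..1} (\<lambda>t. clinfun_apply (g (t *\<^sub>R x)) x))"
  have R: "0 < R" using r norm_ge_zero[of x] by linarith
  have M0: "0 \<le> M" using M[of 0] R norm_ge_zero[of "g 0"] by (simp, linarith)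
  have mem: "t *\<^sub>R y \<in> ball 0 R" if "t \<in> {0..1}" "y \<in> ball 0 R" for t :: real and y :: 'a
    using that mult_left_le_one_le[of "norm y" t] by simp
  have mem_ball: "y \<in> ball 0 R" if "t \<in> {0..1}" "y \<in> ball (t *\<^sub>R x) r" for t y
    using that mult_left_le_one_le[of "norm x" t] r norm_triangle_ineq[of "t *\<^sub>R x" "y - t *\<^sub>R x"]
    by (simp add: dist_norm norm_minus_commute)
  have xR: "x \<in> ball 0 R" using r by simp
  have vder: "((\<lambda>t. g (t *\<^sub>R y)) has_vector_derivative clinfun_apply (D (t *\<^sub>R y)) y) (at t within {0..1})"
    if "t \<in> {0..1}" "y \<in> ball 0 R" for t y
  proof -
    have "((\<lambda>t. t *\<^sub>R y) has_derivative (\<lambda>s. s *\<^sub>R y)) (at t within {0..1})"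
      by (auto intro!: derivative_eq_intros)
    from has_derivative_compose[OF this D[OF mem[OF that], unfolded has_cderiv_def]]
    show ?thesis
      by (simp add: has_vector_derivative_def clinfun_apply_scaleR)
  qed
  have f_int: "((\<lambda>t. clinfun_apply (g (t *\<^sub>R y)) y) has_integral f y) {0..1}" if "y \<in> ball 0 R" for y
  proof -
    have "continuous_on {0..1} (\<lambda>t. g (t *\<^sub>R y))"
      unfolding continuous_on_eq_continuous_within
      using has_vector_derivative_continuous[OF vder[OF _ that]] by (rule ballI)
    then have "continuous_on {0..1} (\<lambda>t. clinfun_apply (g (t *\<^sub>R y)) y)"
      by (rule bounded_linear.continuous_on[OF bounded_linear_clinfun_eval])
    then show ?thesis
      unfolding f_def by (intro integrable_integral integrable_continuous_real)
  qed
  have ftc: "((\<lambda>t. t *\<^sub>R clinfun_apply (clinfun_apply (D (t *\<^sub>R x)) x) h + clinfun_apply (g (t *\<^sub>R x)) h)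
      has_integral clinfun_apply (g x) h) {0..1}" for h
  proof -
    have "((\<lambda>t. t *\<^sub>R clinfun_apply (g (t *\<^sub>R x)) h) has_vector_derivative
        (t *\<^sub>R clinfun_apply (clinfun_apply (D (t *\<^sub>R x)) x) h + 1 *\<^sub>R clinfun_apply (g (t *\<^sub>R x)) h))
        (at t within {0..1})" if "t \<in> {0..1}" for t
      by (rule has_vector_derivative_scaleR[OF DERIV_ident
          bounded_linear.has_vector_derivative[OF bounded_linear_clinfun_eval vder[OF that xR]]])
    from fundamental_theorem_of_calculus[OF _ this] show ?thesis by simp
  qed
  have remainder: "cmod (f (x + h) - f x - clinfun_apply (g x) h)
      \<le> (32 * M * norm x / r\<^sup>2 + 18 * M / r) * (norm h)\<^sup>2" if h: "norm h \<le> r / 2" for h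
  proof -
    let ?G = "\<lambda>t. clinfun_apply (g (t *\<^sub>R (x + h))) (x + h) - clinfun_apply (g (t *\<^sub>R x)) x
      - (t *\<^sub>R clinfun_apply (clinfun_apply (D (t *\<^sub>R x)) x) h + clinfun_apply (g (t *\<^sub>R x)) h)"
    have "x + h \<in> ball 0 R"
      using h r norm_triangle_ineq[of x h] by simp
    then have int: "(?G has_integral (f (x + h) - f x - clinfun_apply (g x) h)) (cbox 0 1)"
      unfolding box_real by (intro has_integral_diff f_int ftc xR)
    have bnd: "norm (?G t) \<le> (32 * M * norm x / r\<^sup>2 + 18 * M / r) * (norm h)\<^sup>2"
      if "t \<in> cbox 0 1" for t
    proof -
      have t: "t \<in> {0..1}" using that by simp
      have th: "norm (t *\<^sub>R h) \<le> norm h"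
        using t mult_left_le_one_le[of "norm h" t] by simp
      have bd: "cmod (ev_comp k g u) \<le> M * norm k" if "u \<in> ball (t *\<^sub>R x) r" for k u
        unfolding ev_comp_def
        using norm_clinfun_apply_le[of "g u" k] mult_right_mono[OF M[OF mem_ball[OF t that]], of "norm k"]
        by simp
      define E where "E k u = cdifferential (ev_comp k g) u" for k u
      have E: "has_cderiv (ev_comp k g) (E k u) u"
        and E_eq: "clinfun_apply (E k u) h = clinfun_apply (clinfun_apply (D u) h) k"
        if "u \<in> ball (t *\<^sub>R x) r" for k u h
        unfolding E_def by (rule has_cderiv_ev_comp[OF D[OF mem_ball[OF t that]]])+
      have th_small: "norm (t *\<^sub>R h) \<le> r / 2" using th h by (rule order_trans)
      have taylor: "cmod (ev_comp x g (t *\<^sub>R x + t *\<^sub>R h) - ev_comp x g (t *\<^sub>R x)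
          - clinfun_apply (E x (t *\<^sub>R x)) (t *\<^sub>R h)) \<le> 32 * (M * norm x) * (norm (t *\<^sub>R h) / r)\<^sup>2"
        by (rule Taylor_remainder_bound[OF r(1) E bd th_small])
      have lip: "cmod (ev_comp h g (t *\<^sub>R x + t *\<^sub>R h) - ev_comp h g (t *\<^sub>R x))
          \<le> 18 * (M * norm h) / r * norm (t *\<^sub>R h)"
        by (rule local_Lipschitz_bound[OF r(1) E bd th_small])
      have "?G t = (ev_comp x g (t *\<^sub>R x + t *\<^sub>R h) - ev_comp x g (t *\<^sub>R x)
          - clinfun_apply (E x (t *\<^sub>R x)) (t *\<^sub>R h))
          + (ev_comp h g (t *\<^sub>R x + t *\<^sub>R h) - ev_comp h g (t *\<^sub>R x))"
        using E_eq[of "t *\<^sub>R x" x h] sym[OF mem[OF t xR], of x h] r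
        by (simp add: ev_comp_def scaleR_add_right clinfun_apply_add clinfun_apply_scaleR)
      also have "norm \<dots> \<le> 32 * (M * norm x) * (norm (t *\<^sub>R h) / r)\<^sup>2
          + 18 * (M * norm h) / r * norm (t *\<^sub>R h)"
        using taylor lip by (rule norm_triangle_mono)
      also have "\<dots> \<le> 32 * (M * norm x) * (norm h / r)\<^sup>2 + 18 * (M * norm h) / r * norm h"
        by (intro add_mono mult_left_mono power_mono divide_right_mono th) (use M0 r in simp_all)
      also have "\<dots> = (32 * M * norm x / r\<^sup>2 + 18 * M / r) * (norm h)\<^sup>2"
        by (simp only: power_divide power2_eq_square distrib_right) (simp add: mult_ac)
      finally show ?thesis .
    qed
    have nonneg: "0 \<le> (32 * M * norm x / r\<^sup>2 + 18 * M / r) * (norm h)\<^sup>2"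
      using M0 r by (intro mult_nonneg_nonneg add_nonneg_nonneg divide_nonneg_nonneg) simp_all
    have content: "measure lborel (cbox 0 (1::real)) = 1" by simp
    show ?thesis
      using has_integral_bound[OF nonneg int bnd] unfolding content mult_1_right .
  qed
  have "0 < r / 2" using r by simp
  from has_derivative_of_quadratic_remainder[OF bounded_linear_clinfun_apply this remainder]
  show ?thesis unfolding has_cderiv_def f_def .
qed

section \<open>The Lipschitz norm and the norm of the differential\<close>

lemma norm_derivative_le_Lipschitz:
  assumes D: "has_cderiv f D x" and "open S" "x \<in> S"
    and L: "\<And>y. y \<in> S \<Longrightarrow> norm (f y - f x) \<le> L * norm (y - x)" and "0 \<le> L"
  shows "norm D \<le> L"
proof (rule norm_clinfun_le[OF \<open>0 \<le> L\<close>])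
  fix h
  define \<delta> where "\<delta> n = inverse (real (Suc n))" for n
  have \<delta>: "\<And>n. 0 < \<delta> n" "\<delta> \<longlonglongrightarrow> 0"
    unfolding \<delta>_def using LIMSEQ_inverse_real_of_nat by simp_all
  have "(\<lambda>n. x + \<delta> n *\<^sub>R h) \<longlonglongrightarrow> x + 0 *\<^sub>R h"
    by (intro tendsto_intros \<delta>)
  then have "\<forall>\<^sub>F n in sequentially. x + \<delta> n *\<^sub>R h \<in> S"
    using assms(2,3) by (simp add: topological_tendstoD)
  then have ev: "\<forall>\<^sub>F n in sequentially. norm ((1 / \<delta> n) *\<^sub>R (f (x + \<delta> n *\<^sub>R h) - f x)) \<le> L * norm h"
  proof eventually_elim
    case (elim n)
    then show ?case
      using L[OF elim] \<delta>(1)[of n] unfolding norm_scaleR by (simp add: pos_divide_le_eq mult_ac)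
  qed
  show "norm (clinfun_apply D h) \<le> L * norm h"
    by (rule tendsto_upperbound[OF tendsto_norm[OF has_derivative_directional_limit[OF D[unfolded has_cderiv_def] \<delta>]] ev]) simp
qed

lemma Lipschitz_on_ball_of_bounded_derivative:
  assumes D: "\<And>x. x \<in> ball 0 1 \<Longrightarrow> has_cderiv f (D x) x" and B: "\<And>x. x \<in> ball 0 1 \<Longrightarrow> norm (D x) \<le> B"
    and "x \<in> ball 0 1" "y \<in> ball 0 1"
  shows "norm (f x - f y) \<le> B * norm (x - y)"
proof (rule differentiable_bound[OF convex_ball[of 0 1] _ _ assms(3,4)])
  show "(f has_derivative clinfun_apply (D z)) (at z within ball 0 1)" if "z \<in> ball 0 1" for z
    using D[OF that] unfolding has_cderiv_def by (rule has_derivative_at_withinI)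
  show "onorm (clinfun_apply (D z)) \<le> B" if "z \<in> ball 0 1" for z
    using B[OF that] by (simp add: norm_clinfun.rep_eq)
qed

lemma HL0I:
  assumes "zero_off_ball f" and D: "\<And>x. x \<in> ball 0 1 \<Longrightarrow> has_cderiv f (D x) x"
    and B: "\<And>x. x \<in> ball 0 1 \<Longrightarrow> norm (D x) \<le> B" and "f 0 = 0"
  shows "f \<in> HL0"
proof -
  have B0: "0 \<le> B" using B[of 0] norm_ge_zero[of "D 0"] by (simp, linarith)
  have lip: "cmod (f x - f y) \<le> B * norm (x - y)" if "x \<in> ball 0 1" "y \<in> ball 0 1" for x y
    by (rule Lipschitz_on_ball_of_bounded_derivative[OF D B that])
  have "cmod (f x) \<le> B" if "x \<in> ball 0 1" for x
    using lip[OF that, of 0] that B0 mult_left_mono[of "norm x" 1 B] \<open>f 0 = 0\<close> by simp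
  then have "bounded (f ` ball 0 1)" by (intro boundedI[of _ B]) auto
  moreover have "B-lipschitz_on (ball 0 1) f"
    using lip B0 by (auto simp: lipschitz_on_def dist_norm)
  ultimately show ?thesis
    using assms unfolding HL0_def Hinf_def holo_ball_def by blast
qed

lemma Hinf_has_cderiv:
  assumes "f \<in> Hinf" "x \<in> ball 0 1"
  shows "has_cderiv f (cdifferential f x) x"
  using assms cdifferential_eqI unfolding Hinf_def holo_ball_def by fastforce

lemma Lip_norm_bound:
  assumes "f \<in> HL0" "x \<in> ball 0 1" "y \<in> ball 0 1"
  shows "cmod (f x - f y) \<le> Lip_norm f * norm (x - y)"
proof (cases "x = y")
  case False
  obtain C where C: "C-lipschitz_on (ball 0 1) f" using assms unfolding HL0_def by blast
  have "cmod (f x - f y) / norm (x - y) \<le> Lip_norm f"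
    unfolding Lip_norm_def
  proof (rule cSup_upper)
    show "bdd_above {cmod (f x - f y) / norm (x - y) |x y. x \<in> ball 0 1 \<and> y \<in> ball 0 1 \<and> x \<noteq> y}"
      using lipschitz_onD[OF C] by (intro bdd_aboveI[of _ C]) (auto simp: dist_norm field_simps)
  qed (use False assms in blast)
  then show ?thesis using False by (simp add: field_simps)
qed simp

lemma Lip_norm_le:
  fixes f :: "'a::complex_banach \<Rightarrow> complex"
  assumes "\<exists>x :: 'a. x \<noteq> 0"
    and "\<And>x y. x \<in> ball 0 1 \<Longrightarrow> y \<in> ball 0 1 \<Longrightarrow> cmod (f x - f y) \<le> B * norm (x - y)"
  shows "Lip_norm f \<le> B"
  unfolding Lip_norm_def
proof (rule cSup_least)
  obtain z :: 'a where "z \<noteq> 0" using assms(1) by blast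
  then have "(1 / (2 * norm z)) *\<^sub>R z \<in> ball 0 1" "(0 :: 'a) \<in> ball 0 1" "(1 / (2 * norm z)) *\<^sub>R z \<noteq> 0"
    by auto
  then show "{cmod (f x - f y) / norm (x - y) |x y. x \<in> ball 0 1 \<and> y \<in> ball 0 1 \<and> x \<noteq> y} \<noteq> {}"
    by blast
next
  fix q assume "q \<in> {cmod (f x - f y) / norm (x - y) |x y. x \<in> ball 0 1 \<and> y \<in> ball 0 1 \<and> x \<noteq> y}"
  then show "q \<le> B" using assms(2) by (auto simp: field_simps)
qed

lemma norm_differential_le:
  fixes f :: "'a::complex_banach \<Rightarrow> complex"
  assumes "\<exists>x :: 'a. x \<noteq> 0" "f \<in> HL0" "x \<in> ball 0 1"
  shows "norm (cdifferential f x) \<le> Lip_norm f"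
proof (rule norm_derivative_le_Lipschitz[OF _ open_ball assms(3)])
  show "has_cderiv f (cdifferential f x) x"
    using assms(2,3) by (intro Hinf_has_cderiv) (auto simp: HL0_def)
  \<comment> \<open>The Lipschitz norm is nonnegative because the ball contains two distinct points.\<close>
  obtain z :: 'a where "z \<noteq> 0" using assms(1) by blast
  define w where "w = (1 / (2 * norm z)) *\<^sub>R z"
  have w: "w \<in> ball 0 1" "0 < norm w" using \<open>z \<noteq> 0\<close> by (auto simp: w_def)
  have "cmod (f w - f 0) \<le> Lip_norm f * norm w"
    using Lip_norm_bound[OF assms(2) w(1), of 0] by simp
  then have "0 \<le> Lip_norm f * norm w" by (rule order_trans[OF norm_ge_zero])
  then show "0 \<le> Lip_norm f" using \<open>0 < norm w\<close> by (simp add: zero_le_mult_iff)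
qed (use Lip_norm_bound[OF assms(2)] assms(3) in blast)

lemma Hinf_norm_differential:
  fixes f :: "'a::complex_banach \<Rightarrow> complex"
  assumes nt: "\<exists>x :: 'a. x \<noteq> 0" and f: "f \<in> HL0"
  shows "Hinf_norm (differential_map f) = Lip_norm f"
proof (rule antisym)
  have le: "norm (differential_map f x) \<le> Lip_norm f" if "x \<in> ball 0 1" for x
    using norm_differential_le[OF nt f that] that by (simp add: differential_map_def)
  then show "Hinf_norm (differential_map f) \<le> Lip_norm f"
    unfolding Hinf_norm_def by (intro cSUP_least) auto
  have "norm (cdifferential f x) \<le> Hinf_norm (differential_map f)" if "x \<in> ball 0 1" for x
  proof -
    have "norm (differential_map f x) \<le> Hinf_norm (differential_map f)"
      unfolding Hinf_norm_def
    proof (rule cSUP_upper[OF that])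
      show "bdd_above ((\<lambda>x. norm (differential_map f x)) ` ball 0 1)"
        using le by (rule bdd_aboveI2)
    qed
    then show ?thesis using that by (simp add: differential_map_def)
  qed
  then show "Lip_norm f \<le> Hinf_norm (differential_map f)"
    using f by (intro Lip_norm_le nt Lipschitz_on_ball_of_bounded_derivative[OF Hinf_has_cderiv])
      (simp_all add: HL0_def)
qed

section \<open>The range of the differential\<close>

text \<open>
  Each function $x \<mapsto> df(x)(k)$ is holomorphic, and $df$ is bounded by the Lipschitz constant, so
  $df$ is holomorphic in norm; the compatibility condition is the symmetry of second derivatives.
\<close>
lemma differential_map_in_Hinf_s:
  fixes f :: "'a::complex_banach \<Rightarrow> complex"
  assumes nt: "\<exists>x :: 'a. x \<noteq> 0" and f: "f \<in> HL0"
  shows "differential_map f \<in> Hinf_s e"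
proof -
  let ?g = "differential_map f"
  have fH: "f \<in> Hinf" using f by (simp add: HL0_def)
  obtain M where M: "\<And>x. x \<in> ball 0 1 \<Longrightarrow> cmod (f x) \<le> M"
    using fH unfolding Hinf_def bounded_iff by blast
  have sub: "ball u (1 - norm u) \<subseteq> ball 0 1" for u :: 'a
  proof
    fix y assume "y \<in> ball u (1 - norm u)"
    then show "y \<in> ball 0 1"
      using norm_triangle_sub[of y u] by (simp add: dist_norm norm_minus_commute)
  qed
  define E where "E k u = cdifferential (ev_comp k ?g) u" for k u
  have E: "has_cderiv (ev_comp k ?g) (E k u) u" if u: "u \<in> ball 0 1" for u k
  proof -
    have "0 < 1 - norm u" using u by simp
    from has_cderiv_directional_derivative[where f = f and D = "cdifferential f" and M = M and k = k,
        OF this Hinf_has_cderiv[OF fH] M]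
    obtain F where "has_cderiv (\<lambda>x. clinfun_apply (cdifferential f x) k) F u"
      using sub by blast
    then have "has_cderiv (ev_comp k ?g) F u"
      by (rule has_cderiv_transform_open[OF _ open_ball u]) (simp add: ev_comp_def differential_map_def)
    then show ?thesis
      unfolding E_def by (simp add: cdifferential_eqI)
  qed
  have le: "norm (?g x) \<le> Lip_norm f" if "x \<in> ball 0 1" for x
    using norm_differential_le[OF nt f that] that by (simp add: differential_map_def)
  have "\<exists>D. has_cderiv ?g D u" if u: "u \<in> ball 0 1" for u
  proof -
    have "0 < 1 - norm u" using u by simp
    from has_cderiv_of_weakstar_has_cderiv[where g = ?g and G = E and M = "Lip_norm f", OF this E le]
    show ?thesis using sub by blast
  qed
  then have "holo_ball ?g" unfolding holo_ball_def by blast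
  moreover have "bounded (?g ` ball 0 1)"
    using le by (intro boundedI[of _ "Lip_norm f"]) blast
  moreover have "zero_off_ball ?g"
    by (simp add: zero_off_ball_def differential_map_def)
  ultimately have "?g \<in> Hinf" unfolding Hinf_def by blast
  moreover have "clinfun_apply (E h u) k = clinfun_apply (E k u) h" if u: "u \<in> ball 0 1" for u h k
  proof (rule second_derivative_symmetric[where f = f and D = "cdifferential f" and M = M
      and r = "1 - norm u" and u = u and E = "\<lambda>k. E k u"])
    show "0 < 1 - norm u" using u by simp
    show "has_cderiv (\<lambda>x. clinfun_apply (cdifferential f x) k) (E k u) u" for k
      by (rule has_cderiv_transform_open[OF E[OF u] open_ball u]) (simp add: ev_comp_def differential_map_def)
  qed (use sub Hinf_has_cderiv[OF fH] M in blast)+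
  ultimately show ?thesis
    by (simp add: Hinf_s_def E_def ev_comp_def[of _ "cdifferential _"])
qed

text \<open>
  The compatibility condition says that the bilinear map $dg(u)$ is symmetric on pairs of basis
  vectors. Continuous linear maps that agree on the basis are equal; applied in one variable and
  then in the other, this makes $dg(u)$ symmetric, and the Poincare lemma provides a primitive.
\<close>
lemma Hinf_s_subset_range_differential_map:
  fixes e :: "nat \<Rightarrow> 'a::complex_banach"
  assumes e: "schauder_basis e" and g: "g \<in> Hinf_s e"
  shows "\<exists>f\<in>HL0. differential_map f = g"
proof -
  have gH: "g \<in> Hinf" using g by (simp add: Hinf_s_def)
  obtain M where M: "\<And>x. x \<in> ball 0 1 \<Longrightarrow> norm (g x) \<le> M"
    using gH unfolding Hinf_def bounded_iff by blast
  have sym: "clinfun_apply (clinfun_apply (cdifferential g u) h) k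
      = clinfun_apply (clinfun_apply (cdifferential g u) k) h" if u: "u \<in> ball 0 1" for u h k
  proof -
    let ?D = "cdifferential g u"
    define E where "E k = cdifferential (ev_comp k g) u" for k
    have E_eq: "clinfun_apply (E k) h = clinfun_apply (clinfun_apply ?D h) k" for k h
      unfolding E_def by (rule has_cderiv_ev_comp[OF Hinf_has_cderiv[OF gH u]])
    have base: "clinfun_apply (E (e n)) (e k) = clinfun_apply (E (e k)) (e n)" for n k
      using g u by (simp add: Hinf_s_def E_def ev_comp_def[of _ "cdifferential _"])
    \<comment> \<open>One variable at a time: first one of the two arguments stays a basis vector.\<close>
    have "E (e n) = clinfun_apply ?D (e n)" for n
      by (rule clinfun_eqI_schauder_basis[OF e]) (metis base E_eq)
    then have "E k = clinfun_apply ?D k" for k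
      by (intro clinfun_eqI_schauder_basis[OF e]) (metis E_eq)
    then show ?thesis using E_eq by metis
  qed
  define f where "f x = (if x \<in> ball 0 1 then integral {0..1} (\<lambda>t. clinfun_apply (g (t *\<^sub>R x)) x) else 0)" for x
  have f: "has_cderiv f (g x) x" if x: "x \<in> ball 0 1" for x
  proof -
    have "has_cderiv (\<lambda>x. integral {0..1} (\<lambda>t. clinfun_apply (g (t *\<^sub>R x)) x)) (g x) x"
      by (rule has_cderiv_radial_primitive[where R = 1 and r = "1 - norm x", OF _ _ Hinf_has_cderiv[OF gH] M sym])
        (use x in auto)
    then show ?thesis
      by (rule has_cderiv_transform_open[OF _ open_ball x]) (simp add: f_def)
  qed
  have "f \<in> HL0"
    by (rule HL0I[OF _ f M]) (auto simp: f_def zero_off_ball_def clinfun_apply_zero)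
  moreover have "differential_map f = g"
    using cdifferential_eqI[OF f] gH
    by (auto simp: differential_map_def Hinf_def zero_off_ball_def)
  ultimately show ?thesis by blast
qed

theorem corollary3p6:
  fixes e :: "nat \<Rightarrow> 'a::complex_banach"
  assumes "schauder_basis e"
  shows "isometric_isomorphism HL0 Lip_norm (Hinf_s e) Hinf_norm
           (differential_map :: ('a \<Rightarrow> complex) \<Rightarrow> 'a \<Rightarrow> 'a cdual)"
proof -
  note nt = schauder_basis_nontrivial[OF assms]
  have der: "has_cderiv f (cdifferential f x) x" if "f \<in> HL0" "x \<in> ball 0 1" for f :: "'a \<Rightarrow> complex" and x
    using that by (intro Hinf_has_cderiv) (auto simp: HL0_def)
  have "differential_map (\<lambda>x. f x + g x) = (\<lambda>x. differential_map f x + differential_map g x)"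
    if "f \<in> HL0" "g \<in> HL0" for f g :: "'a \<Rightarrow> complex"
    using cdifferential_eqI[OF has_cderiv_add[OF der der]] that
    by (auto simp: differential_map_def fun_eq_iff)
  moreover have "differential_map (\<lambda>x. c *\<^sub>C f x) = (\<lambda>x. c *\<^sub>C differential_map f x)"
    if "f \<in> HL0" for c and f :: "'a \<Rightarrow> complex"
    using cdifferential_eqI[OF has_cderiv_scaleC[OF der]] that
    by (auto simp: differential_map_def fun_eq_iff)
  moreover have "differential_map ` HL0 = Hinf_s e"
    using differential_map_in_Hinf_s[OF nt] Hinf_s_subset_range_differential_map[OF assms] by blast
  ultimately show ?thesis
    using Hinf_norm_differential[OF nt] unfolding isometric_isomorphism_def by blast
qed

end
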